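(* Let $\Omega\subseteq\mathbb{R}^d$ with $d\in\mathbb{N}$, let $\mathcal{B}^d$ be the Borel $\sigma$-algebra on $\Omega$ and $\mathcal{B}$ the Borel $\sigma$-algebra on $\mathbb{R}$, let $(\Omega,\mathcal{B}^d,\mu)$ be a probability space and let $\mathcal{L}:(\Omega,\mathcal{B}^d)\to(\mathbb{R},\mathcal{B})$ be measurable. Assume that the push-forward measure $\mathcal{L}_\#\mu$ has only finitely many atoms $r_1,\dots,r_N$ (pairwise distinct, all atoms being listed), and set $$\Delta_i=\mu(\{z\in\Omega:\mathcal{L}(z)=r_i\})>0,\qquad \alpha_i=\mu(\{z\in\Omega:\mathcal{L}(z)>r_i\}),$$ where the atoms are numbered so that $\alpha_1<\alpha_1+\Delta_1\le\alpha_2<\alpha_2+\Delta_2\le\cdots$. Define $\Phi:\Omega\to[0,1]$ by $$\Phi(x)=\mu(\{z\in\Omega:\mathcal{L}(z)>\mathcal{L}(x)\}).$$ Then the law of $\Phi$ under $\mu$ (i.e. the push-forward measure $\Phi_\#\mu=\mu\circ\Phi^{-1}$ on $[0,1]$) is $$\Phi_\#\mu=\sum_{i}\Delta_i\,\delta_{\alpha_i}+\operatorname{Unif}\Big([0,1]\setminus\bigcup_i[\alpha_i,\alpha_i+\Delta_i]\Big).$$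
   Context: $\mathcal{L}_\#\mu=\mu\circ\mathcal{L}^{-1}$ is the push-forward of $\mu$ under $\mathcal{L}$. An atom of $\mathcal{L}_\#\mu$ is a point $r\in\mathbb{R}$ with $\mathcal{L}_\#\mu(\{r\})>0$; outside $r_1,\dots,r_N$ the measure $\mathcal{L}_\#\mu$ has no point masses. $\delta_p$ is the Dirac measure at $p$. For a Borel set $I\subseteq[0,1]$, $\operatorname{Unif}(I)$ denotes here the (unnormalized) restriction of Lebesgue measure to $I$, i.e. the measure with density $\mathbf{1}_I$, so that the total mass of the right-hand side is $1$. *)

theory Defs
  imports "HOL-Probability.Probability"
begin

definition atoms :: "real measure \<Rightarrow> real set" where
  "atoms M = {r. emeasure M {r} > 0}"

abbreviation borel01 :: "real measure" where
  "borel01 \<equiv> restrict_space borel {0..1}"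

text \<open>The unnormalized uniform measure on a Borel set \<open>I \<subseteq> [0,1]\<close>, as a measure on \<open>[0,1]\<close>.\<close>
definition Unif :: "real set \<Rightarrow> real measure" where
  "Unif I = density (restrict_space lborel {0..1}) (indicator I)"

text \<open>
  The library has no addition of measures. The sums below are taken setwise. The finite sum
  takes the ambient \<open>\<sigma>\<close>-algebra from \<open>B\<close>, so that the empty sum is the null measure on \<open>B\<close>.
  As \<^const>\<open>measure_of\<close> falls back to the null measure on set functions that are not
  \<open>\<sigma>\<close>-additive, the lemmas confirm that the sums have the intended values.
\<close>
definition measure_plus :: "'a measure \<Rightarrow> 'a measure \<Rightarrow> 'a measure" where
  "measure_plus M K = measure_of (space M) (sets M) (\<lambda>A. emeasure M A + emeasure K A)"

definition measure_sum :: "'a measure \<Rightarrow> 'i set \<Rightarrow> ('i \<Rightarrow> 'a measure) \<Rightarrow> 'a measure" where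
  "measure_sum B I F = measure_of (space B) (sets B) (\<lambda>A. \<Sum>i\<in>I. emeasure (F i) A)"

lemma space_measure_plus [simp]: "space (measure_plus M K) = space M"
  and sets_measure_plus [simp, measurable_cong]: "sets (measure_plus M K) = sets M"
  by (simp_all add: measure_plus_def)

lemma space_measure_sum [simp]: "space (measure_sum B I F) = space B"
  and sets_measure_sum [simp, measurable_cong]: "sets (measure_sum B I F) = sets B"
  by (simp_all add: measure_sum_def)

lemma emeasure_measure_plus:
  assumes "sets K = sets M" "A \<in> sets M"
  shows "emeasure (measure_plus M K) A = emeasure M A + emeasure K A"
proof (rule emeasure_measure_of[OF measure_plus_def])
  show "countably_additive (sets (measure_plus M K)) (\<lambda>A. emeasure M A + emeasure K A)"
  proof (rule countably_additiveI)
    fix X :: "nat \<Rightarrow> 'a set"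
    assume "range X \<subseteq> sets (measure_plus M K)" "disjoint_family X"
    then show "(\<Sum>i. emeasure M (X i) + emeasure K (X i)) =
      emeasure M (\<Union>i. X i) + emeasure K (\<Union>i. X i)"
      using assms by (simp add: suminf_add[symmetric] suminf_emeasure)
  qed
qed (use assms in \<open>auto simp: positive_def dest: sets.sets_into_space\<close>)

lemma emeasure_measure_sum:
  fixes B :: "'a measure"
  assumes "\<And>i. i \<in> I \<Longrightarrow> sets (F i) = sets B" "A \<in> sets B"
  shows "emeasure (measure_sum B I F) A = (\<Sum>i\<in>I. emeasure (F i) A)"
proof (rule emeasure_measure_of[OF measure_sum_def])
  show "countably_additive (sets (measure_sum B I F)) (\<lambda>A. \<Sum>i\<in>I. emeasure (F i) A)"
  proof (rule countably_additiveI)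
    fix X :: "nat \<Rightarrow> 'a set"
    assume "range X \<subseteq> sets (measure_sum B I F)" "disjoint_family X"
    then show "(\<Sum>n. \<Sum>i\<in>I. emeasure (F i) (X n)) = (\<Sum>i\<in>I. emeasure (F i) (\<Union>n. X n))"
      using assms by (simp add: suminf_sum suminf_emeasure)
  qed
qed (use assms in \<open>auto simp: positive_def dest: sets.sets_into_space\<close>)

lemma space_Unif [simp]: "space (Unif I) = {0..1}"
  and sets_Unif [simp, measurable_cong]: "sets (Unif I) = sets borel01"
  by (simp_all add: Unif_def space_restrict_space sets_restrict_space)

lemma emeasure_Unif:
  assumes "I \<in> sets borel" "I \<subseteq> {0..1}" "A \<in> sets borel01"
  shows "emeasure (Unif I) A = emeasure lborel (A \<inter> I)"
proof -
  have A: "A \<in> sets borel" "A \<subseteq> {0..1}"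
    using assms(3) by (auto simp: sets_restrict_space)
  have "emeasure (Unif I) A
      = (\<integral>\<^sup>+x. indicator I x * indicator A x \<partial>restrict_space lborel {0..1})"
    unfolding Unif_def using assms
    by (intro emeasure_density)
       (auto simp: sets_restrict_space intro!: measurable_restrict_space1)
  also have "\<dots> = (\<integral>\<^sup>+x. indicator (A \<inter> I) x \<partial>lborel)"
    using A by (subst nn_integral_restrict_space)
      (auto intro!: nn_integral_cong split: split_indicator)
  finally show ?thesis using A assms by simp
qed

end

theory Submission
  imports Defs
begin

text \<open>
  Let \<open>C\<close> be the distribution function of \<open>L\<close> and \<open>I\<close> its quantile function, so that \<open>I(\<omega>)\<close> has
  the law of \<open>L\<close> when \<open>\<omega>\<close> is uniform on \<open>(0,1)\<close>, and \<open>\<Phi> = 1 - C(L)\<close>. If \<open>I(\<omega>)\<close> is not an atom,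
  then \<open>C\<close> is continuous there and \<open>1 - C(I(\<omega>)) = 1 - \<omega>\<close>, which is the uniform part. Up to endpoints,
  \<open>I(\<omega>)\<close> is the atom \<open>r\<^sub>i\<close> exactly if \<open>1 - \<omega>\<close> lies in \<open>[\<alpha>\<^sub>i, \<alpha>\<^sub>i + \<Delta>\<^sub>i]\<close>, and then \<open>1 - C(I(\<omega>)) = \<alpha>\<^sub>i\<close>.
\<close>

text \<open>Substitution with slope -1, whose Jacobian is 1. With \<open>t = 1\<close> it passes
  from the uniform variable \<omega> to \<open>1 - \<omega>\<close>.\<close>

lemma emeasure_lborel_reflect:
  fixes A :: "real set"
  assumes "A \<in> sets borel"
  shows "emeasure lborel {x. t - x \<in> A} = emeasure lborel A"
proof -
  have [measurable]: "A \<in> sets borel" by fact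
  have "emeasure lborel A = (\<integral>\<^sup>+x. indicator A (t + (-1) * x) \<partial>lborel)"
    using nn_integral_real_affine[of "indicator A" "-1" t] by simp
  also have "\<dots> = (\<integral>\<^sup>+x. indicator {x. t - x \<in> A} x \<partial>lborel)"
    by (intro nn_integral_cong) (auto split: split_indicator)
  finally show ?thesis by simp
qed

context cdf_distribution
begin

lemma cdf_eq_add_singleton: "C x = measure M {..<x} + measure M {x}"
proof -
  have "C x = measure M ({..<x} \<union> {x})"
    unfolding cdf_def by (rule arg_cong[where f = "measure M"]) auto
  also have "\<dots> = measure M {..<x} + measure M {x}"
    by (rule finite_measure_Union) auto
  finally show ?thesis .
qed

text \<open>The left side is the left limit of \<open>C\<close> at \<open>I \<omega>\<close>, and to
  the left of \<open>I \<omega>\<close> the Galois connection \<open>pseudoinverse\<close> keeps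
  \<open>C\<close> below \<omega>.\<close>

lemma measure_lessThan_quantile_le:
  assumes "0 < \<omega>" "\<omega> < 1"
  shows "measure M {..<I \<omega>} \<le> \<omega>"
proof (rule tendsto_upperbound[OF cdf_at_left])
  have "C x \<le> \<omega>" if "x < I \<omega>" for x
    using that pseudoinverse[OF assms, of x] by linarith
  then show "\<forall>\<^sub>F x in at_left (I \<omega>). C x \<le> \<omega>"
    by (auto simp: eventually_at_filter)
qed simp

text \<open>In general \<omega> lies between the left limit of \<open>C\<close> at
  \<open>I \<omega>\<close> and \<open>C (I \<omega>)\<close>; without mass at
  \<open>I \<omega>\<close> the two bounds coincide.\<close>

lemma cdf_quantile_eq:
  assumes "0 < \<omega>" "\<omega> < 1" "measure M {I \<omega>} = 0"
  shows "C (I \<omega>) = \<omega>"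
  using measure_lessThan_quantile_le[OF assms(1,2)] pseudoinverse[OF assms(1,2), of "I \<omega>"]
    cdf_eq_add_singleton[of "I \<omega>"] assms(3) by simp

text \<open>The quantile function is constant across a jump of \<open>C\<close>. The inequality at
  the lower end is strict because at that value \<open>C\<close> may already have reached \<omega>
  to the left of \<open>x\<close>.\<close>

lemma quantile_eqI:
  assumes "0 < \<omega>" "\<omega> < 1" "measure M {..<x} < \<omega>" "\<omega> \<le> C x"
  shows "I \<omega> = x"
proof (rule antisym)
  show "I \<omega> \<le> x"
    using pseudoinverse[OF assms(1,2)] assms(4) by blast
  show "x \<le> I \<omega>"
  proof (rule ccontr)
    assume "\<not> x \<le> I \<omega>"
    then have "C (I \<omega>) \<le> measure M {..<x}"
      unfolding cdf_def by (intro finite_measure_mono) auto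
    moreover have "\<omega> \<le> C (I \<omega>)"
      using pseudoinverse[OF assms(1,2), of "I \<omega>"] by simp
    ultimately show False using assms(3) by linarith
  qed
qed

text \<open>\<open>distr_I_eq_M\<close> spelled out on sets, so that claims about \<open>M\<close>
  become claims about Lebesgue measure on the unit interval.\<close>

lemma emeasure_eq_lborel_quantile:
  assumes "B \<in> sets borel"
  shows "emeasure M B = emeasure lborel {\<omega> \<in> {0<..<1}. I \<omega> \<in> B}"
    and "{\<omega> \<in> {0<..<1}. I \<omega> \<in> B} \<in> sets borel"
proof -
  let ?U = "restrict_space lborel {0<..<1::real}"
  have meas: "I \<in> ?U \<rightarrow>\<^sub>M borel"
    using measurable_CI by (simp cong: measurable_cong_sets add: sets_restrict_space)
  have vimage: "I -` B \<inter> space ?U = {\<omega> \<in> {0<..<1}. I \<omega> \<in> B}"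
    by (auto simp: space_restrict_space)
  have "emeasure M B = emeasure (distr ?U borel I) B"
    by (simp only: distr_I_eq_M)
  also have "\<dots> = emeasure ?U {\<omega> \<in> {0<..<1}. I \<omega> \<in> B}"
    by (simp only: emeasure_distr[OF meas assms] vimage)
  also have "\<dots> = emeasure lborel {\<omega> \<in> {0<..<1}. I \<omega> \<in> B}"
    by (rule emeasure_restrict_space) auto
  finally show "emeasure M B = emeasure lborel {\<omega> \<in> {0<..<1}. I \<omega> \<in> B}" .
  show "{\<omega> \<in> {0<..<1}. I \<omega> \<in> B} \<in> sets borel"
    using measurable_sets[OF meas assms] unfolding vimage
    by (subst (asm) sets_restrict_space_iff) simp_all
qed

text \<open>This is the uniform part. In the quantile coordinate \<omega>, both sides measure sets
  that agree outside a finite set, after the reflection \<omega> to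
  \<open>1 - \<omega>\<close>.\<close>

lemma emeasure_survival_nonatoms:
  assumes S: "finite S" "\<And>x. measure M {x} > 0 \<longleftrightarrow> x \<in> S" and [measurable]: "A \<in> sets borel"
  shows "emeasure M ({x. 1 - C x \<in> A} - S) =
    emeasure lborel (A \<inter> ({0..1} - (\<Union>x\<in>S. {1 - C x..1 - C x + measure M {x}})))"
proof -
  let ?J = "{0..1} - (\<Union>x\<in>S. {1 - C x..1 - C x + measure M {x}})"
  let ?B = "{x. 1 - C x \<in> A} - S"
  \<comment> \<open>Endpoints of the unit interval and of the jumps of \<open>C\<close>. At 0 and 1
    the closed and the open unit interval differ; at \<open>measure M {..<x}\<close> the closed
    interval of \<open>x\<close> may contain \<open>1 - \<omega>\<close> although
    \<open>I \<omega>\<close> is smaller than \<open>x\<close>.\<close>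
  let ?E = "{0, 1} \<union> C ` S \<union> (\<lambda>x. measure M {..<x}) ` S"
  have J [measurable]: "?J \<in> sets borel"
    using S(1) by (intro sets.Diff sets.finite_UN) auto
  have S_borel [measurable]: "S \<in> sets borel"
    using S(1) by (simp add: finite_imp_closed borel_closed)
  have B: "?B \<in> sets borel" by measurable
  have eq: "\<omega> \<in> {\<omega> \<in> {0<..<1}. I \<omega> \<in> ?B} \<longleftrightarrow> \<omega> \<in> {\<omega>. 1 - \<omega> \<in> A \<inter> ?J}"
    if "\<omega> \<notin> ?E" for \<omega>
  proof (cases "0 < \<omega> \<and> \<omega> < 1")
    case True
    \<comment> \<open>By \<open>cdf_eq_add_singleton\<close>, the interval condition on
      \<open>1 - \<omega>\<close> means that \<omega> lies between \<open>measure M {..<x}\<close>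
      and \<open>C x\<close>.\<close>
    have atom: "I \<omega> \<in> S \<longleftrightarrow> (\<exists>x\<in>S. 1 - \<omega> \<in> {1 - C x..1 - C x + measure M {x}})"
    proof
      assume "I \<omega> \<in> S"
      then show "\<exists>x\<in>S. 1 - \<omega> \<in> {1 - C x..1 - C x + measure M {x}}"
        using True measure_lessThan_quantile_le[of \<omega>] pseudoinverse[of \<omega> "I \<omega>"]
          cdf_eq_add_singleton[of "I \<omega>"] by (intro bexI[of _ "I \<omega>"]) auto
    next
      assume "\<exists>x\<in>S. 1 - \<omega> \<in> {1 - C x..1 - C x + measure M {x}}"
      then obtain x where x: "x \<in> S" "measure M {..<x} \<le> \<omega>" "\<omega> \<le> C x"
        using cdf_eq_add_singleton by auto
      moreover have "\<omega> \<noteq> measure M {..<x}" using that x(1) by auto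
      ultimately show "I \<omega> \<in> S" using quantile_eqI[of \<omega> x] True by auto
    qed
    \<comment> \<open>Hence off the atoms \<open>1 - C (I \<omega>) \<in> A\<close> reads
      \<open>1 - \<omega> \<in> A\<close>, while \<open>atom\<close> turns the removal of
      \<open>S\<close> into the removal of the intervals.\<close>
    have "C (I \<omega>) = \<omega>" if "I \<omega> \<notin> S"
      using that S(2)[of "I \<omega>"] True by (intro cdf_quantile_eq) (auto simp: zero_less_measure_iff)
    then show ?thesis using True atom by auto
  next
    case False
    then show ?thesis using that by auto
  qed
  have "emeasure M ?B = emeasure lborel {\<omega> \<in> {0<..<1}. I \<omega> \<in> ?B}"
    by (rule emeasure_eq_lborel_quantile(1)[OF B])
  also have "\<dots> = emeasure lborel {\<omega>. 1 - \<omega> \<in> A \<inter> ?J}"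
  proof (rule emeasure_eq_AE)
    have "?E \<in> null_sets lborel"
      using S(1) by (intro finite_imp_null_set_lborel) auto
    then show "AE \<omega> in lborel. \<omega> \<in> {\<omega> \<in> {0<..<1}. I \<omega> \<in> ?B} \<longleftrightarrow> \<omega> \<in> {\<omega>. 1 - \<omega> \<in> A \<inter> ?J}"
      by (rule AE_I') (use eq in \<open>blast intro: ccontr\<close>)
    have AJ [measurable]: "A \<inter> ?J \<in> sets borel" using J by auto
    have "Measurable.pred borel (\<lambda>\<omega>::real. 1 - \<omega> \<in> A \<inter> ?J)"
      by measurable
    then show "{\<omega>. 1 - \<omega> \<in> A \<inter> ?J} \<in> sets lborel" by (simp add: pred_def)
    show "{\<omega> \<in> {0<..<1}. I \<omega> \<in> ?B} \<in> sets lborel"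
      using emeasure_eq_lborel_quantile(2)[OF B] by simp
  qed
  also have "\<dots> = emeasure lborel (A \<inter> ?J)"
    using J by (intro emeasure_lborel_reflect) auto
  finally show ?thesis .
qed

text \<open>The finitely many atoms in the preimage are split off; each \<open>x\<close> contributes
  its full mass at the single value \<open>1 - C x\<close>, which gives the Dirac terms.\<close>

lemma emeasure_survival:
  assumes S: "finite S" "\<And>x. measure M {x} > 0 \<longleftrightarrow> x \<in> S" and [measurable]: "A \<in> sets borel"
  shows "emeasure M {x. 1 - C x \<in> A} =
    (\<Sum>x\<in>S. emeasure M {x} * indicator A (1 - C x)) +
    emeasure lborel (A \<inter> ({0..1} - (\<Union>x\<in>S. {1 - C x..1 - C x + measure M {x}})))"
proof -
  let ?B = "{x. 1 - C x \<in> A}"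
  have S_borel [measurable]: "S \<in> sets borel"
    using S(1) by (simp add: finite_imp_closed borel_closed)
  have B: "?B \<in> sets borel" by measurable
  have "emeasure M ?B = emeasure M ((?B \<inter> S) \<union> (?B - S))"
    by (rule arg_cong[where f = "emeasure M"]) auto
  also have "\<dots> = emeasure M (?B \<inter> S) + emeasure M (?B - S)"
    using B S_borel by (intro plus_emeasure[symmetric]) auto
  also have "emeasure M (?B \<inter> S) = (\<Sum>x\<in>?B \<inter> S. emeasure M {x})"
    using S(1) by (intro emeasure_eq_sum_singleton) auto
  also have "\<dots> = (\<Sum>x\<in>S. emeasure M {x} * indicator A (1 - C x))"
    using S(1) by (intro sum.mono_neutral_cong_left) (auto split: split_indicator)
  finally show ?thesis
    by (simp only: emeasure_survival_nonatoms[OF assms])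
qed

end

theorem lemma2:
  fixes \<Omega> :: "(real ^ 'd) set"
    and \<mu> :: "(real ^ 'd) measure"
    and L \<Phi> :: "real ^ 'd \<Rightarrow> real"
    and N :: nat
    and r \<Delta> \<alpha> :: "nat \<Rightarrow> real"
  assumes "sets \<mu> = sets (restrict_space borel \<Omega>)"
    and "prob_space \<mu>"
    and "L \<in> \<mu> \<rightarrow>\<^sub>M borel"
    and "inj_on r {1..N}"
    and "atoms (distr \<mu> borel L) = r ` {1..N}"
    and "\<And>i. i \<in> {1..N} \<Longrightarrow> \<Delta> i = measure \<mu> {z \<in> \<Omega>. L z = r i}"
    and "\<And>i. i \<in> {1..N} \<Longrightarrow> \<alpha> i = measure \<mu> {z \<in> \<Omega>. L z > r i}"
    and "\<And>i. i \<in> {1..N} \<Longrightarrow> \<alpha> i < \<alpha> i + \<Delta> i"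
    and "\<And>i. i \<in> {1..<N} \<Longrightarrow> \<alpha> i + \<Delta> i \<le> \<alpha> (i + 1)"
    and "\<And>x. x \<in> \<Omega> \<Longrightarrow> \<Phi> x = measure \<mu> {z \<in> \<Omega>. L z > L x}"
  shows "\<Phi> \<in> \<mu> \<rightarrow>\<^sub>M borel01 \<and>
    distr \<mu> borel01 \<Phi> =
      measure_plus
        (measure_sum borel01 {1..N} (\<lambda>i. scale_measure (ennreal (\<Delta> i)) (return borel01 (\<alpha> i))))
        (Unif ({0..1} - (\<Union>i\<in>{1..N}. {\<alpha> i..\<alpha> i + \<Delta> i})))"
proof -
  interpret \<mu>: prob_space \<mu> by fact
  note L [measurable] = assms(3)
  have space: "space \<mu> = \<Omega>"
    using sets_eq_imp_space_eq[OF assms(1)] by (simp add: space_restrict_space)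
  \<comment> \<open>From here on only the law of \<open>L\<close> on the real line matters.\<close>
  define \<nu> where "\<nu> = distr \<mu> borel L"
  interpret \<nu>: cdf_distribution \<nu>
    unfolding \<nu>_def cdf_distribution_def using L by simp
  have \<nu>_eq: "measure \<nu> B = measure \<mu> {z \<in> \<Omega>. L z \<in> B}" if "B \<in> sets borel" for B
    using that by (auto simp: \<nu>_def measure_distr space intro!: arg_cong[where f = "measure \<mu>"])
  have survival: "measure \<mu> {z \<in> \<Omega>. L z > t} = 1 - \<nu>.C t" for t
  proof -
    have "measure \<mu> {z \<in> \<Omega>. L z > t} = measure \<nu> (space \<nu> - {..t})"
      by (subst \<nu>_eq[symmetric, of "{t<..}", simplified])
         (auto intro!: arg_cong[where f = "measure \<nu>"])
    then show ?thesis
      by (simp only: cdf_def) (subst \<nu>.prob_compl, auto)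
  qed
  have \<Phi>: "\<Phi> x = 1 - \<nu>.C (L x)" if "x \<in> \<Omega>" for x
    using assms(10)[OF that] survival by simp
  have \<alpha>: "\<alpha> i = 1 - \<nu>.C (r i)" and \<Delta>: "\<Delta> i = measure \<nu> {r i}" if "i \<in> {1..N}" for i
    using assms(6,7)[OF that] survival \<nu>_eq[of "{r i}"] by simp_all
  have S: "measure \<nu> {x} > 0 \<longleftrightarrow> x \<in> r ` {1..N}" for x
    unfolding assms(5)[symmetric] atoms_def \<nu>_def[symmetric]
    by (simp add: \<nu>.emeasure_eq_measure)
  have range: "1 - \<nu>.C t \<in> {0..1}" for t
    using \<nu>.cdf_bounded_prob[of t] \<nu>.cdf_nonneg[of t] by simp
  \<comment> \<open>\<open>\<Phi>\<close> is prescribed on \<Omega> only, which is the whole space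
    of \<mu>, so measurability may be checked on the formula.\<close>
  have "\<Phi> \<in> \<mu> \<rightarrow>\<^sub>M borel \<longleftrightarrow> (\<lambda>x. 1 - \<nu>.C (L x)) \<in> \<mu> \<rightarrow>\<^sub>M borel"
    by (intro measurable_cong) (simp add: space \<Phi>)
  moreover have "(\<lambda>x. 1 - \<nu>.C (L x)) \<in> \<mu> \<rightarrow>\<^sub>M borel"
    by measurable
  ultimately have meas: "\<Phi> \<in> \<mu> \<rightarrow>\<^sub>M borel01"
    using \<Phi> range by (intro measurable_restrict_space2) (auto simp: space)
  let ?J = "{0..1} - (\<Union>i\<in>{1..N}. {\<alpha> i..\<alpha> i + \<Delta> i})"
  let ?D = "\<lambda>i. scale_measure (ennreal (\<Delta> i)) (return borel01 (\<alpha> i))"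
  have "distr \<mu> borel01 \<Phi> = measure_plus (measure_sum borel01 {1..N} ?D) (Unif ?J)"
  proof (rule measure_eqI)
    fix A assume "A \<in> sets (distr \<mu> borel01 \<Phi>)"
    then have A: "A \<in> sets borel01" by simp
    then have A_borel [measurable]: "A \<in> sets borel" by (auto simp: sets_restrict_space)
    have J: "?J = {0..1} - (\<Union>x\<in>r ` {1..N}. {1 - \<nu>.C x..1 - \<nu>.C x + measure \<nu> {x}})"
      using \<alpha> \<Delta> by auto
    have "emeasure (distr \<mu> borel01 \<Phi>) A = emeasure \<mu> (\<Phi> -` A \<inter> space \<mu>)"
      by (rule emeasure_distr[OF meas A])
    also have "\<Phi> -` A \<inter> space \<mu> = L -` {x. 1 - \<nu>.C x \<in> A} \<inter> space \<mu>"
      using \<Phi> by (auto simp: space)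
    also have "emeasure \<mu> \<dots> = emeasure \<nu> {x. 1 - \<nu>.C x \<in> A}"
      unfolding \<nu>_def by (rule emeasure_distr[symmetric]) (simp_all flip: \<nu>_def)
    also have "\<dots> = (\<Sum>x\<in>r ` {1..N}. emeasure \<nu> {x} * indicator A (1 - \<nu>.C x)) +
        emeasure lborel (A \<inter> ?J)"
      unfolding J by (intro \<nu>.emeasure_survival S A_borel) simp
    \<comment> \<open>Since the \<open>r i\<close> are distinct, summing over atoms is summing over
      indices, and each term is a weighted Dirac measure evaluated at \<open>A\<close>.\<close>
    also have "(\<Sum>x\<in>r ` {1..N}. emeasure \<nu> {x} * indicator A (1 - \<nu>.C x)) =
        (\<Sum>i\<in>{1..N}. emeasure (?D i) A)"
      unfolding sum.reindex[OF assms(4)] o_def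
      using A by (intro sum.cong) (simp_all add: \<alpha> \<Delta> \<nu>.emeasure_eq_measure)
    also have "\<dots> = emeasure (measure_sum borel01 {1..N} ?D) A"
      using A by (intro emeasure_measure_sum[symmetric]) simp_all
    also have "emeasure lborel (A \<inter> ?J) = emeasure (Unif ?J) A"
      using A by (intro emeasure_Unif[symmetric]) auto
    finally show "emeasure (distr \<mu> borel01 \<Phi>) A =
        emeasure (measure_plus (measure_sum borel01 {1..N} ?D) (Unif ?J)) A"
      using A by (simp add: emeasure_measure_plus)
  qed simp
  with meas show ?thesis by blast
qed

end
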